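(* Let $G$ be a finite simple connected graph. The following are equivalent: (1) $G$ has at most one trivial distance ideal over $\mathbb{R}$; (2) $G$ is $\{P_4,\mathsf{paw},\mathsf{diamond},C_4\}$-free; (3) $G$ is (isomorphic to) an induced subgraph of a star $K_{1,n}$ or of a complete graph $K_n$, for some positive integer $n$.
   Context: For a connected graph $G$ with vertex set $V$, $|V|=n$, let $d_G(u,v)$ be the number of edges in a shortest path from $u$ to $v$, let $D(G)$ be the distance matrix $(d_G(u,v))_{u,v\in V}$, let $X_G=\{x_u:u\in V\}$ be indeterminates, and let $D(G,X_G)=\mathrm{diag}(X_G)+D(G)$ be the generalized distance matrix. For a commutative ring $\mathcal{R}$ and $1\le i\le n$, the $i$-th distance ideal $I_i^{\mathcal{R}}(G,X_G)\subseteq \mathcal{R}[X_G]$ is the ideal generated by all $i\times i$ minors of $D(G,X_G)$ (determinants of arbitrary $i\times i$ submatrices). An ideal is trivial if it equals $\langle 1\rangle$. "Over $\mathbb{R}$" means $\mathcal{R}=\mathbb{R}$, the real numbers. $P_4$ is the path on 4 vertices; $C_4$ is the cycle on 4 vertices; $\mathsf{paw}$ is a triangle with one pendant edge attached at one of its vertices (4 vertices); $\mathsf{diamond}$ is $K_4$ with one edge removed. A graph is $\mathcal{F}$-free if no induced subgraph of it is isomorphic to a graph in $\mathcal{F}$. *)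

theory Defs
  imports
    "HOL-Library.Poly_Mapping"
    "HOL-Algebra.Ideal"
    "Jordan_Normal_Form.Determinant"
    "Graph_Theory.Digraph_Isomorphism"
    "Graph_Theory.Kuratowski"
begin

text \<open>
  A finite simple graph is a \<^locale>\<open>pair_graph\<close>: a finite, loop-free, symmetric digraph whose arcs
  are pairs of vertices. An undirected edge is represented by its two orientations.
\<close>

definition graph_of_edges :: "'v set \<Rightarrow> ('v \<times> 'v) set \<Rightarrow> 'v pair_pre_digraph" where
  "graph_of_edges V E = \<lparr> pverts = V, parcs = E \<union> E\<inverse> \<rparr>"

definition P4 :: "nat pair_pre_digraph" where
  "P4 = graph_of_edges {0, 1, 2, 3} {(0, 1), (1, 2), (2, 3)}"

definition C4 :: "nat pair_pre_digraph" where
  "C4 = graph_of_edges {0, 1, 2, 3} {(0, 1), (1, 2), (2, 3), (3, 0)}"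

definition paw :: "nat pair_pre_digraph" where
  "paw = graph_of_edges {0, 1, 2, 3} {(0, 1), (0, 2), (1, 2), (2, 3)}"

definition diamond :: "nat pair_pre_digraph" where
  "diamond = graph_of_edges {0, 1, 2, 3} {(0, 1), (0, 2), (1, 2), (1, 3), (2, 3)}"

lemma pair_graph_forbidden:
  "pair_graph P4" "pair_graph C4" "pair_graph paw" "pair_graph diamond"
  by (unfold_locales;
      auto simp: P4_def C4_def paw_def diamond_def graph_of_edges_def symmetric_def sym_def)+

definition graph_free :: "'w pair_pre_digraph set \<Rightarrow> 'v pair_pre_digraph \<Rightarrow> bool" where
  "graph_free \<F> G \<longleftrightarrow>
     \<not> (\<exists>H F. induced_subgraph H (with_proj G) \<and> F \<in> \<F> \<and> digraph_iso H (with_proj F))"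

text \<open>The value is only meaningful if \<open>v\<close> is reachable from \<open>u\<close>.\<close>

definition graph_dist :: "'v pair_pre_digraph \<Rightarrow> 'v \<Rightarrow> 'v \<Rightarrow> nat" where
  "graph_dist G u v = (LEAST k. \<exists>p. pre_digraph.apath (with_proj G) u p v \<and> length p = k)"

text \<open>
  Polynomials with coefficients in \<open>'r\<close> and indeterminates indexed by \<open>'v\<close>: a monomial maps each
  indeterminate to its exponent, and a polynomial maps each monomial to its coefficient.
\<close>

type_synonym ('v, 'r) mpoly = "('v \<Rightarrow>\<^sub>0 nat) \<Rightarrow>\<^sub>0 'r"

definition indet :: "'v \<Rightarrow> ('v, 'r::comm_ring_1) mpoly" where
  "indet u = Poly_Mapping.single (Poly_Mapping.single u 1) 1"

text \<open>The type \<open>'v\<close> may have elements outside \<open>V\<close>; these must not occur as indeterminates.\<close>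

definition mpoly_ring :: "'v set \<Rightarrow> ('v, 'r::comm_ring_1) mpoly ring" where
  "mpoly_ring V =
     \<lparr> carrier = {p. \<forall>m \<in> Poly_Mapping.keys p. Poly_Mapping.keys m \<subseteq> V},
       monoid.mult = (*), one = 1, ring.zero = 0, add = (+) \<rparr>"

lemma cring_mpoly_ring: "cring (mpoly_ring V :: ('v, 'r::comm_ring_1) mpoly ring)"
proof (rule cringI)
  let ?R = "mpoly_ring V :: ('v, 'r) mpoly ring"
  show "abelian_group ?R"
  proof (rule abelian_groupI)
    fix p q assume "p \<in> carrier ?R" "q \<in> carrier ?R"
    then show "p \<oplus>\<^bsub>?R\<^esub> q \<in> carrier ?R"
      using Poly_Mapping.keys_add[of p q] by (fastforce simp: mpoly_ring_def)
  next
    fix p assume "p \<in> carrier ?R"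
    then show "\<exists>q\<in>carrier ?R. q \<oplus>\<^bsub>?R\<^esub> p = \<zero>\<^bsub>?R\<^esub>"
      by (intro bexI[of _ "- p"]) (auto simp: mpoly_ring_def)
  qed (auto simp: mpoly_ring_def algebra_simps)
  show "comm_monoid ?R"
  proof (rule comm_monoidI)
    fix p q assume pq: "p \<in> carrier ?R" "q \<in> carrier ?R"
    have "Poly_Mapping.keys m \<subseteq> V" if m: "m \<in> Poly_Mapping.keys (p * q)" for m
    proof -
      obtain a b where "a \<in> Poly_Mapping.keys p" "b \<in> Poly_Mapping.keys q" "m = a + b"
        using Poly_Mapping.keys_mult[of p q] m by auto
      with pq show ?thesis
        using Poly_Mapping.keys_add[of a b] by (fastforce simp: mpoly_ring_def)
    qed
    then show "p \<otimes>\<^bsub>?R\<^esub> q \<in> carrier ?R"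
      by (auto simp: mpoly_ring_def)
  qed (auto simp: mpoly_ring_def algebra_simps)
qed (auto simp: mpoly_ring_def algebra_simps)

definition gen_distance_matrix ::
    "'v pair_pre_digraph \<Rightarrow> 'v \<Rightarrow> 'v \<Rightarrow> ('v, 'r::comm_ring_1) mpoly" where
  "gen_distance_matrix G u v = (if u = v then indet u else 0) + of_nat (graph_dist G u v)"

text \<open>
  The vertices carry no order, so a square submatrix is given by a list of its row vertices and a
  list of its column vertices. Reordering these lists only changes the sign of the minor, so the
  ideal generated by the minors is the same as for any fixed order of the vertices.
\<close>

definition minors ::
    "nat \<Rightarrow> 'v pair_pre_digraph \<Rightarrow> ('v, 'r::comm_ring_1) mpoly set" where
  "minors i G =
     {det (mat i i (\<lambda>(a, b). gen_distance_matrix G (rs ! a) (cs ! b))) | rs cs.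
        length rs = i \<and> distinct rs \<and> set rs \<subseteq> pverts G \<and>
        length cs = i \<and> distinct cs \<and> set cs \<subseteq> pverts G}"

definition distance_ideal ::
    "nat \<Rightarrow> 'v pair_pre_digraph \<Rightarrow> ('v, 'r::comm_ring_1) mpoly set" where
  "distance_ideal i G = genideal (mpoly_ring (pverts G)) (minors i G)"

definition trivial_ideal :: "('p, 'm) ring_scheme \<Rightarrow> 'p set \<Rightarrow> bool" where
  "trivial_ideal R I \<longleftrightarrow> I = genideal R {\<one>\<^bsub>R\<^esub>}"

definition trivial_distance_ideal ::
    "'r::comm_ring_1 itself \<Rightarrow> 'v pair_pre_digraph \<Rightarrow> nat \<Rightarrow> bool" where
  "trivial_distance_ideal _ G i \<longleftrightarrow>
     trivial_ideal (mpoly_ring (pverts G)) (distance_ideal i G :: ('v, 'r) mpoly set)"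

end

theory Submission
  imports Defs
begin

text \<open>
  Each forbidden graph, as an induced subgraph, yields a 2 by 2 minor with disjoint row and column
  sets that is a non-zero constant: the entries depend only on adjacency, except that the ends of an
  induced \<open>P\<^sub>4\<close> may be at distance 2 or 3 in \<open>G\<close>, where the minor is 4 minus that distance.
  Conversely, a connected graph without the four induced subgraphs is complete or a star, and then
  the generalized distance matrix has rank one at a suitable real point, so that all minors of size
  at least 2 have a common zero.
\<close>

section \<open>Evaluation of polynomials\<close>

text \<open>Distances are measured in the whole graph, so an induced subgraph does not determine
  them in general. It does for adjacent vertices and for non-adjacent vertices with a common
  neighbour inside it, which covers every entry used except the one between the ends of an induced
  path on four vertices. In a graph with an edge the first ideal is already trivial, so "at most
  one" says that no later ideal is. Working over a field matters: the constant minors 2 and 3 can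
  occur and must be units. For a star with at least two leaves the common zero is forced: with
  centre c and leaves u, v, the minor on rows c, u and columns c, v is 2 x_c - 1, and the minor on
  rows c, u and columns v, u is x_u - 2.\<close>

definition eval_monomial :: "('v \<Rightarrow> 'r::comm_ring_1) \<Rightarrow> ('v \<Rightarrow>\<^sub>0 nat) \<Rightarrow> 'r" where
  "eval_monomial x m = (\<Prod>v\<in>Poly_Mapping.keys m. x v ^ Poly_Mapping.lookup m v)"

definition eval_mpoly :: "('v \<Rightarrow> 'r::comm_ring_1) \<Rightarrow> ('v, 'r) mpoly \<Rightarrow> 'r" where
  "eval_mpoly x p = (\<Sum>m\<in>Poly_Mapping.keys p. Poly_Mapping.lookup p m * eval_monomial x m)"

text \<open>Absent indeterminates contribute \<open>x v ^ 0 = 1\<close>; this allows two monomials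
  to be compared over a common finite set.\<close>

lemma eval_monomial_superset:
  assumes "finite A" "Poly_Mapping.keys m \<subseteq> A"
  shows "eval_monomial x m = (\<Prod>v\<in>A. x v ^ Poly_Mapping.lookup m v)"
  unfolding eval_monomial_def
  using assms by (intro prod.mono_neutral_left) (auto simp: in_keys_iff)

lemma eval_monomial_add: "eval_monomial x (m + n) = eval_monomial x m * eval_monomial x n"
proof -
  let ?A = "Poly_Mapping.keys m \<union> Poly_Mapping.keys n"
  have "eval_monomial x (m + n) = (\<Prod>v\<in>?A. x v ^ Poly_Mapping.lookup (m + n) v)"
    using Poly_Mapping.keys_add[of m n] by (intro eval_monomial_superset) auto
  also have "\<dots> = (\<Prod>v\<in>?A. x v ^ Poly_Mapping.lookup m v) * (\<Prod>v\<in>?A. x v ^ Poly_Mapping.lookup n v)"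
    by (simp add: lookup_add power_add prod.distrib)
  also have "\<dots> = eval_monomial x m * eval_monomial x n"
    by (subst (1 2) eval_monomial_superset[where A = ?A]) auto
  finally show ?thesis .
qed

lemma eval_mpoly_add: "eval_mpoly x (p + q) = eval_mpoly x p + eval_mpoly x q"
  unfolding eval_mpoly_def
  \<comment> \<open>Coefficients may cancel, so the support of the sum can be smaller than the
    union; the rule only asks that the summand be additive in the coefficient and vanish at
    0.\<close>
  by (rule setsum_keys_plus_distrib[where f = "\<lambda>m c. c * eval_monomial x m"])
    (auto simp: distrib_right)

lemma eval_mpoly_single: "eval_mpoly x (Poly_Mapping.single m c) = c * eval_monomial x m"
  by (simp add: eval_mpoly_def)

text \<open>Turns the step of \<open>update_induct\<close> into an addition of a single term, so
  that additivity of evaluation applies.\<close>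

lemma update_eq_add_single:
  "a \<notin> Poly_Mapping.keys p \<Longrightarrow> Poly_Mapping.update a b p = p + Poly_Mapping.single a b"
  by (rule poly_mapping_eqI) (auto simp: lookup_update lookup_add lookup_single when_def in_keys_iff)

lemma eval_mpoly_single_mult:
  "eval_mpoly x (Poly_Mapping.single m c * q) = c * eval_monomial x m * eval_mpoly x q"
proof (induction q rule: update_induct)
  case const
  then show ?case by (simp add: eval_mpoly_def)
next
  case (update q n d)
  then show ?case
    by (simp add: update_eq_add_single distrib_left eval_mpoly_add mult_single eval_mpoly_single
        eval_monomial_add mult_ac)
qed

lemma eval_mpoly_mult: "eval_mpoly x (p * q) = eval_mpoly x p * eval_mpoly x q"
proof (induction p rule: update_induct)
  case const
  then show ?case by (simp add: eval_mpoly_def)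
next
  case (update p m c)
  then show ?case
    by (simp add: update_eq_add_single distrib_right eval_mpoly_add eval_mpoly_single_mult
        eval_mpoly_single)
qed

lemma eval_mpoly_one: "eval_mpoly x 1 = 1"
  by (simp add: eval_mpoly_def eval_monomial_def)

lemma eval_mpoly_zero: "eval_mpoly x 0 = 0"
  by (simp add: eval_mpoly_def)

text \<open>Supplies \<open>hom_det\<close>: the value of a minor at a point is the determinant of
  the evaluated submatrix.\<close>

interpretation eval_mpoly: comm_ring_hom "eval_mpoly x"
  by unfold_locales (rule eval_mpoly_add eval_mpoly_mult eval_mpoly_one eval_mpoly_zero)+

lemma eval_mpoly_indet: "eval_mpoly x (indet v) = x v"
  by (simp add: indet_def eval_mpoly_single eval_monomial_def)

lemma eval_mpoly_of_nat: "eval_mpoly x (of_nat n) = of_nat n"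
  by (induction n) (simp_all add: eval_mpoly_add)


section \<open>Trivial distance ideals\<close>

lemma mpoly_ring_simps [simp]:
  "monoid.mult (mpoly_ring V) = (*)" "monoid.one (mpoly_ring V) = 1"
  "ring.zero (mpoly_ring V) = 0" "ring.add (mpoly_ring V) = (+)"
  by (simp_all add: mpoly_ring_def)

lemma single_0_in_mpoly_ring: "Poly_Mapping.single 0 c \<in> carrier (mpoly_ring V)"
  by (simp add: mpoly_ring_def)

text \<open>The determinant is taken with the operations of the whole polynomial type. Its Leibniz
  expansion uses only sums, products and signs, under which the carrier is closed.\<close>

lemma det_in_mpoly_ring:
  assumes A: "A \<in> carrier_mat n n"
    and entries: "\<And>i j. i < n \<Longrightarrow> j < n \<Longrightarrow> A $$ (i, j) \<in> carrier (mpoly_ring V)"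
  shows "det A \<in> carrier (mpoly_ring V)"
proof -
  interpret R: cring "mpoly_ring V" by (rule cring_mpoly_ring)
  note closed = R.add.m_closed[simplified] R.m_closed[simplified]
  have prod_closed: "prod f I \<in> carrier (mpoly_ring V)"
    if "\<And>i. i \<in> I \<Longrightarrow> f i \<in> carrier (mpoly_ring V)" for f and I :: "nat set"
    using that R.one_closed by (induction I rule: infinite_finite_induct) (auto intro: closed)
  have sum_closed: "sum f I \<in> carrier (mpoly_ring V)"
    if "\<And>i. i \<in> I \<Longrightarrow> f i \<in> carrier (mpoly_ring V)" for f and I :: "(nat \<Rightarrow> nat) set"
    using that R.zero_closed by (induction I rule: infinite_finite_induct) (auto intro: closed)
  have sign_closed: "signof p \<in> carrier (mpoly_ring V)" for p :: "nat \<Rightarrow> nat"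
    by (simp add: mpoly_ring_def sign_def)
  show ?thesis
    unfolding det_def'[OF A]
    by (intro sum_closed closed prod_closed entries sign_closed) (auto dest: permutes_in_image)
qed

text \<open>An indeterminate occurs only on the diagonal, where it is that of the row
  vertex.\<close>

lemma gen_distance_matrix_in_mpoly_ring:
  assumes "u \<in> V"
  shows "gen_distance_matrix G u v \<in> carrier (mpoly_ring V)"
  using assms Poly_Mapping.keys_add[of "indet u" "of_nat (graph_dist G u u)"]
  by (fastforce simp: gen_distance_matrix_def mpoly_ring_def indet_def
      simp flip: single_of_nat split: if_splits)

lemma minors_in_mpoly_ring: "minors i G \<subseteq> carrier (mpoly_ring (pverts G))"
proof
  fix p assume "p \<in> minors i G"
  then obtain rs cs where p: "p = det (mat i i (\<lambda>(a, b). gen_distance_matrix G (rs ! a) (cs ! b)))"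
    and "length rs = i" "set rs \<subseteq> pverts G"
    by (auto simp: minors_def)
  then show "p \<in> carrier (mpoly_ring (pverts G))"
    unfolding p
    by (intro det_in_mpoly_ring) (auto intro!: gen_distance_matrix_in_mpoly_ring subsetD[OF _ nth_mem])
qed

lemma trivial_distance_ideal_iff_one:
  "trivial_distance_ideal TYPE('r::comm_ring_1) G i \<longleftrightarrow>
     (1 :: ('v, 'r) mpoly) \<in> distance_ideal i (G :: 'v pair_pre_digraph)"
proof -
  interpret R: cring "mpoly_ring (pverts G) :: ('v, 'r) mpoly ring" by (rule cring_mpoly_ring)
  interpret I: ideal "distance_ideal i G" "mpoly_ring (pverts G) :: ('v, 'r) mpoly ring"
    unfolding distance_ideal_def by (rule R.genideal_ideal[OF minors_in_mpoly_ring])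
  show ?thesis
    using I.one_imp_carrier R.genideal_one R.one_closed
    by (auto simp: trivial_distance_ideal_def trivial_ideal_def)
qed

lemma minors_subset_distance_ideal: "minors i G \<subseteq> distance_ideal i G"
  by (auto simp: distance_ideal_def genideal_def)

text \<open>Over a field a non-zero constant is a unit: multiplying it by its inverse puts 1 into
  the ideal.\<close>

lemma trivial_if_constant_minor:
  fixes c :: "'r::field" and G :: "'v pair_pre_digraph"
  assumes "Poly_Mapping.single 0 c \<in> minors i G" "c \<noteq> 0"
  shows "trivial_distance_ideal TYPE('r) G i"
proof -
  interpret R: cring "mpoly_ring (pverts G) :: ('v, 'r) mpoly ring" by (rule cring_mpoly_ring)
  interpret I: ideal "distance_ideal i G" "mpoly_ring (pverts G) :: ('v, 'r) mpoly ring"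
    unfolding distance_ideal_def by (rule R.genideal_ideal[OF minors_in_mpoly_ring])
  have "Poly_Mapping.single 0 c \<in> (distance_ideal i G :: ('v, 'r) mpoly set)"
    using assms(1) minors_subset_distance_ideal by blast
  from I.I_l_closed[OF this single_0_in_mpoly_ring[of "inverse c"]] show ?thesis
    using assms(2) by (simp add: trivial_distance_ideal_iff_one mult_single)
qed

text \<open>The polynomials vanishing at \<open>x\<close> form an ideal; it contains all the minors
  but not 1.\<close>

lemma not_trivial_if_common_zero:
  fixes x :: "'v \<Rightarrow> 'r::comm_ring_1"
  assumes "\<And>p. p \<in> minors i G \<Longrightarrow> eval_mpoly x p = 0"
  shows "\<not> trivial_distance_ideal TYPE('r) G i"
proof
  let ?R = "mpoly_ring (pverts G) :: ('v, 'r) mpoly ring"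
  let ?I = "{p \<in> carrier ?R. eval_mpoly x p = 0}"
  interpret R: cring ?R by (rule cring_mpoly_ring)
  have "ideal ?I ?R"
  proof (rule idealI)
    show "subgroup ?I (add_monoid ?R)"
    proof (rule R.add.subgroupI)
      fix p assume p: "p \<in> ?I"
      \<comment> \<open>The inverse in the ring record is not the type class minus by definition;
        uniqueness of inverses identifies the two.\<close>
      then have "\<ominus>\<^bsub>?R\<^esub> p = - p"
        by (intro R.minus_equality) (auto simp: mpoly_ring_def)
      with p show "\<ominus>\<^bsub>?R\<^esub> p \<in> ?I"
        using R.add.inv_closed[of p] by (auto simp: eval_mpoly.hom_uminus)
    next
      show "?I \<noteq> {}" using R.zero_closed by auto
    qed (use R.add.m_closed in \<open>auto simp: eval_mpoly_add\<close>)
  qed (use R.m_closed in \<open>auto simp: eval_mpoly_mult R.ring_axioms\<close>)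
  moreover have "minors i G \<subseteq> ?I"
    using minors_in_mpoly_ring assms by blast
  ultimately have "distance_ideal i G \<subseteq> ?I"
    unfolding distance_ideal_def by (rule R.genideal_minimal)
  moreover assume "trivial_distance_ideal TYPE('r) G i"
  ultimately have "eval_mpoly x 1 = 0"
    by (auto simp: trivial_distance_ideal_iff_one)
  then show False by simp
qed

text \<open>The outer product factors through square matrices supported on the first column and the
  first row. Since \<open>n\<close> is at least 2, the second factor has a zero row, namely row
  1.\<close>

lemma det_rank_one:
  fixes y z :: "nat \<Rightarrow> 'a::comm_ring_1"
  assumes "2 \<le> n"
  shows "det (mat n n (\<lambda>(a, b). y a * z b)) = 0"
proof -
  let ?B = "mat n n (\<lambda>(a, b). if a = 0 then z b else 0)"
  let ?A = "mat n n (\<lambda>(a, b). if b = 0 then y a else 0)"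
  have "mat n n (\<lambda>(a, b). y a * z b) = ?A * ?B"
  proof (rule eq_matI)
    fix a b assume "a < dim_row (?A * ?B)" "b < dim_col (?A * ?B)"
    then have ab: "a < n" "b < n" by auto
    then show "mat n n (\<lambda>(a, b). y a * z b) $$ (a, b) = (?A * ?B) $$ (a, b)"
      by (simp add: scalar_prod_def if_distrib[where f = "\<lambda>t. t * _"] cong: if_cong)
  qed auto
  moreover have "det ?B = 0"
  proof -
    have "?B = mat\<^sub>r n n (\<lambda>i. if i = 1 then 0\<^sub>v n else row ?B i)"
      using assms by (intro eq_matI) auto
    also have "det \<dots> = 0"
      using assms by (intro det_row_0) auto
    finally show ?thesis .
  qed
  ultimately show ?thesis
    by (simp add: det_mult[where n = n])
qed

text \<open>Submatrices of an outer product are outer products, so \<open>x\<close> is a common zero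
  of all minors of size \<open>i\<close>.\<close>

lemma not_trivial_if_rank_one:
  fixes x y z :: "'v \<Rightarrow> 'r::comm_ring_1"
  assumes "2 \<le> i"
    and rank_one: "\<And>u v. u \<in> pverts G \<Longrightarrow> v \<in> pverts G \<Longrightarrow>
      (if u = v then x u else 0) + of_nat (graph_dist G u v) = y u * z v"
  shows "\<not> trivial_distance_ideal TYPE('r) G i"
proof (rule not_trivial_if_common_zero)
  fix p :: "('v, 'r) mpoly" assume "p \<in> minors i G"
  then obtain rs cs where p: "p = det (mat i i (\<lambda>(a, b). gen_distance_matrix G (rs ! a) (cs ! b)))"
    and rs: "length rs = i" "set rs \<subseteq> pverts G" and cs: "length cs = i" "set cs \<subseteq> pverts G"
    by (auto simp: minors_def)
  have "eval_mpoly x (gen_distance_matrix G u v) = y u * z v"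
    if "u \<in> pverts G" "v \<in> pverts G" for u v
  proof -
    have "eval_mpoly x (gen_distance_matrix G u v) =
        (if u = v then x u else 0) + of_nat (graph_dist G u v)"
      unfolding gen_distance_matrix_def eval_mpoly_add eval_mpoly_of_nat
      by (simp add: eval_mpoly_indet)
    then show ?thesis
      using rank_one[OF that] by (rule trans)
  qed
  moreover have "rs ! a \<in> pverts G" "cs ! a \<in> pverts G" if "a < i" for a
    using that rs cs by (auto intro: subsetD[OF _ nth_mem])
  ultimately have "map_mat (eval_mpoly x) (mat i i (\<lambda>(a, b). gen_distance_matrix G (rs ! a) (cs ! b)))
      = mat i i (\<lambda>(a, b). y (rs ! a) * z (cs ! b))"
    by (intro eq_matI) simp_all
  then have "eval_mpoly x p = det (mat i i (\<lambda>(a, b). y (rs ! a) * z (cs ! b)))"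
    unfolding p eval_mpoly.hom_det[symmetric] by (rule arg_cong)
  also have "\<dots> = 0"
    using assms(1) by (rule det_rank_one)
  finally show "eval_mpoly x p = 0" .
qed

section \<open>Constant minors of size one and two\<close>

lemma det_mat_2:
  fixes f :: "nat \<times> nat \<Rightarrow> 'a::comm_ring_1"
  shows "det (mat 2 2 f) = f (0, 0) * f (1, 1) - f (0, 1) * f (1, 0)"
proof -
  have "det (mat 2 2 f) = (\<Sum>j<2. mat 2 2 f $$ (0, j) * cofactor (mat 2 2 f) 0 j)"
    by (rule laplace_expansion_row) auto
  also have "\<dots> = f (0, 0) * f (1, 1) - f (0, 1) * f (1, 0)"
    by (auto simp: numeral_2_eq_2 cofactor_def det_single mat_delete_def)
  finally show ?thesis .
qed

lemma trivial_first_distance_ideal: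
  fixes G :: "'v pair_pre_digraph"
  assumes "u \<in> pverts G" "v \<in> pverts G" "u \<noteq> v" "graph_dist G u v \<noteq> 0"
  shows "trivial_distance_ideal TYPE('r::field_char_0) G 1"
proof (rule trivial_if_constant_minor)
  have "\<exists>rs cs. (of_nat (graph_dist G u v) :: ('v, 'r) mpoly) =
        det (mat 1 1 (\<lambda>(a, b). gen_distance_matrix G (rs ! a) (cs ! b))) \<and>
      length rs = 1 \<and> distinct rs \<and> set rs \<subseteq> pverts G \<and>
      length cs = 1 \<and> distinct cs \<and> set cs \<subseteq> pverts G"
    using assms
    by (intro exI[of _ "[u]"] exI[of _ "[v]"]) (auto simp: det_single gen_distance_matrix_def)
  then show "Poly_Mapping.single 0 (of_nat (graph_dist G u v) :: 'r) \<in> minors 1 G"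
    by (simp add: minors_def)
qed (use assms in simp)

text \<open>Rows \<open>a\<close>, \<open>b\<close> and columns \<open>c\<close>, \<open>d\<close>
  share no vertex, so the minor avoids the diagonal. The inequality between natural numbers says
  that it is non-zero, and characteristic 0 preserves this.\<close>

lemma trivial_second_distance_ideal:
  fixes G :: "'v pair_pre_digraph"
  assumes "{a, b, c, d} \<subseteq> pverts G" "distinct [a, b, c, d]"
    and "graph_dist G a c * graph_dist G b d \<noteq> graph_dist G a d * graph_dist G b c"
  shows "trivial_distance_ideal TYPE('r::field_char_0) G 2"
proof (rule trivial_if_constant_minor)
  let ?d = "\<lambda>u v. of_nat (graph_dist G u v)"
  let ?e = "?d a c * ?d b d - ?d a d * ?d b c :: 'r"
  have "Poly_Mapping.single 0 ?e = (?d a c * ?d b d - ?d a d * ?d b c :: ('v, 'r) mpoly)"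
    by (simp add: single_diff flip: of_nat_mult)
  then have "\<exists>rs cs. (Poly_Mapping.single 0 ?e :: ('v, 'r) mpoly) =
        det (mat 2 2 (\<lambda>(a, b). gen_distance_matrix G (rs ! a) (cs ! b))) \<and>
      length rs = 2 \<and> distinct rs \<and> set rs \<subseteq> pverts G \<and>
      length cs = 2 \<and> distinct cs \<and> set cs \<subseteq> pverts G"
    using assms
    by (intro exI[of _ "[a, b]"] exI[of _ "[c, d]"]) (auto simp: det_mat_2 gen_distance_matrix_def)
  then show "Poly_Mapping.single 0 ?e \<in> minors 2 G"
    unfolding minors_def by blast
  have "graph_dist G a c * graph_dist G b d \<noteq> graph_dist G a d * graph_dist G b c" by fact
  then have "(of_nat (graph_dist G a c * graph_dist G b d) :: 'r)
      \<noteq> of_nat (graph_dist G a d * graph_dist G b c)"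
    by (simp only: of_nat_eq_iff not_False_eq_True)
  then show "?e \<noteq> 0" by simp
qed


section \<open>Distances\<close>

context pair_graph
begin

abbreviation adjacent :: "'a \<Rightarrow> 'a \<Rightarrow> bool" (infix \<open>\<frown>\<close> 50) where
  "u \<frown> v \<equiv> (u, v) \<in> parcs G"

lemma adjacent_sym: "u \<frown> v \<longleftrightarrow> v \<frown> u"
  using arcs_symmetric by blast

lemma not_adjacent_self: "\<not> u \<frown> u"
  using no_loops' by blast

lemma graph_dist_le_length: "apath u p v \<Longrightarrow> graph_dist G u v \<le> length p"
  unfolding graph_dist_def by (rule Least_le) auto

text \<open>Some path has to exist for the \<open>LEAST\<close> in \<open>graph_dist\<close> to be
  attained. Lower bounds on distances come from inspecting the shortest path obtained here.\<close>

lemma apath_of_length_graph_dist: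
  assumes "apath u p v"
  obtains q where "apath u q v" "length q = graph_dist G u v"
proof -
  have "\<exists>q. apath u q v \<and> length q = graph_dist G u v"
    unfolding graph_dist_def by (rule LeastI_ex) (use assms in auto)
  then show thesis using that by blast
qed

lemma graph_dist_self: "u \<in> pverts G \<Longrightarrow> graph_dist G u u = 0"
  using graph_dist_le_length[of u "[]" u] by (simp add: apath_Nil_iff)

lemma graph_dist_pos:
  assumes "apath u p v" "u \<noteq> v"
  shows "1 \<le> graph_dist G u v"
proof -
  obtain q where q: "apath u q v" "length q = graph_dist G u v"
    using assms(1) by (rule apath_of_length_graph_dist)
  with assms(2) show ?thesis by (cases q) (auto simp: apath_Nil_iff)
qed

lemma graph_dist_ge_2:
  assumes "apath u p v" "u \<noteq> v" "\<not> u \<frown> v"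
  shows "2 \<le> graph_dist G u v"
proof -
  obtain q where q: "apath u q v" "length q = graph_dist G u v"
    using assms(1) by (rule apath_of_length_graph_dist)
  have "length q \<noteq> 0" "length q \<noteq> 1"
    using assms(2,3) q(1) by (auto simp: apath_simps length_Suc_conv)
  with q(2) show ?thesis by simp
qed

lemma graph_dist_adjacent:
  assumes "u \<frown> v"
  shows "graph_dist G u v = 1"
proof -
  have "apath u [(u, v)] v" and "u \<noteq> v"
    using assms by (auto simp: apath_simps not_adjacent_self in_arcsD2)
  then show ?thesis
    using graph_dist_le_length[of u "[(u, v)]" v] graph_dist_pos[of u "[(u, v)]" v] by simp
qed

text \<open>The common neighbour bounds the distance from above and non-adjacency from below, so no
  other route in \<open>G\<close> can change it.\<close>

lemma graph_dist_eq_2: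
  assumes "u \<frown> w" "w \<frown> v" "u \<noteq> v" "\<not> u \<frown> v"
  shows "graph_dist G u v = 2"
proof -
  have "apath u [(u, w), (w, v)] v"
    using assms not_adjacent_self by (auto simp: apath_simps in_arcsD2)
  then show ?thesis
    using graph_dist_le_length[of u "[(u, w), (w, v)]" v] graph_dist_ge_2[of u _ v] assms by fastforce
qed

text \<open>Both values are possible: a vertex off the path may be adjacent to both ends.\<close>

lemma graph_dist_path_of_length_3:
  assumes "u \<frown> w" "w \<frown> w'" "w' \<frown> v" "distinct [u, w, w', v]" "\<not> u \<frown> v"
  shows "graph_dist G u v \<in> {2, 3}"
proof -
  have "apath u [(u, w), (w, w'), (w', v)] v"
    using assms by (auto simp: apath_simps in_arcsD2)
  then show ?thesis
    using graph_dist_le_length[of u "[(u, w), (w, w'), (w', v)]" v] graph_dist_ge_2[of u _ v] assms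
    by fastforce
qed

end


section \<open>Induced subgraphs\<close>

text \<open>An isomorphism onto an induced subgraph, reduced to its vertex map. Library isomorphisms
  also carry an arc map and end maps; the bare vertex map composes easily and unfolds to adjacency
  conditions.\<close>

definition embeds :: "'u pair_pre_digraph \<Rightarrow> 'v pair_pre_digraph \<Rightarrow> bool" where
  "embeds F G \<longleftrightarrow> (\<exists>h. inj_on h (pverts F) \<and> h ` pverts F \<subseteq> pverts G \<and>
     (\<forall>u\<in>pverts F. \<forall>v\<in>pverts F. (h u, h v) \<in> parcs G \<longleftrightarrow> (u, v) \<in> parcs F))"

lemma embeds_trans:
  assumes "embeds F G" "embeds G K"
  shows "embeds F K"
proof -
  obtain h where h: "inj_on h (pverts F)" "h ` pverts F \<subseteq> pverts G"
    "\<And>u v. u \<in> pverts F \<Longrightarrow> v \<in> pverts F \<Longrightarrow> (h u, h v) \<in> parcs G \<longleftrightarrow> (u, v) \<in> parcs F"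
    using assms(1) by (auto simp: embeds_def)
  obtain k where k: "inj_on k (pverts G)" "k ` pverts G \<subseteq> pverts K"
    "\<And>u v. u \<in> pverts G \<Longrightarrow> v \<in> pverts G \<Longrightarrow> (k u, k v) \<in> parcs K \<longleftrightarrow> (u, v) \<in> parcs G"
    using assms(2) by (auto simp: embeds_def)
  have "inj_on (k \<circ> h) (pverts F)"
    using h(1,2) k(1) by (blast intro: comp_inj_on inj_on_subset)
  moreover have "(k \<circ> h) ` pverts F \<subseteq> pverts K"
    using h(2) k(2) by auto
  moreover have "((k \<circ> h) u, (k \<circ> h) v) \<in> parcs K \<longleftrightarrow> (u, v) \<in> parcs F"
    if "u \<in> pverts F" "v \<in> pverts F" for u v
    using that h(2,3) k(3) by (auto simp: image_subset_iff)
  ultimately show ?thesis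
    unfolding embeds_def by blast
qed

text \<open>A subgraph of \<open>with_proj G\<close> has \<open>fst\<close> and \<open>snd\<close>
  as its end maps, so the arc map of an isomorphism is forced by the vertex map. Conversely a vertex
  map acts on pairs, and being induced means that the arcs of the image are exactly those of
  \<open>G\<close> inside it.\<close>

lemma iso_induced_subgraph_iff_embeds:
  assumes "pair_wf_digraph F" "pair_wf_digraph G"
  shows "(\<exists>H. induced_subgraph H (with_proj G) \<and> digraph_iso (with_proj F) H) \<longleftrightarrow> embeds F G"
proof
  interpret F: pair_wf_digraph F by fact
  interpret G: pair_wf_digraph G by fact
  assume "\<exists>H. induced_subgraph H (with_proj G) \<and> digraph_iso (with_proj F) H"
  then obtain f where induced: "induced_subgraph (app_iso f (with_proj F)) (with_proj G)"
    and f: "F.digraph_isomorphism f"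
    by (auto simp: digraph_iso_def)
  let ?H = "app_iso f (with_proj F)"
  let ?h = "iso_verts f"
  have inj: "inj_on ?h (pverts F)"
    using f by (simp add: F.digraph_isomorphism_def)
  have H: "?h ` pverts F \<subseteq> pverts G" "tail ?H = fst" "head ?H = snd"
    and arcs_H: "arcs ?H = {e \<in> parcs G. fst e \<in> ?h ` pverts F \<and> snd e \<in> ?h ` pverts F}"
    using induced by (auto simp: induced_subgraph_def subgraph_def compatible_def)
  have iso_arc: "iso_arcs f (u, v) = (?h u, ?h v)" if "(u, v) \<in> parcs F" for u v
    using f that H(2,3) by (fastforce simp: F.digraph_isomorphism_def intro: prod_eqI)
  have "(?h u, ?h v) \<in> parcs G \<longleftrightarrow> (u, v) \<in> parcs F"
    if uv: "u \<in> pverts F" "v \<in> pverts F" for u v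
  proof
    assume "(u, v) \<in> parcs F"
    then have "(?h u, ?h v) \<in> arcs ?H"
      using iso_arc by force
    then show "(?h u, ?h v) \<in> parcs G" by (simp add: arcs_H del: app_iso_simps)
  next
    assume "(?h u, ?h v) \<in> parcs G"
    then have "(?h u, ?h v) \<in> arcs ?H"
      using uv by (simp add: arcs_H del: app_iso_simps)
    \<comment> \<open>A priori the image arc may come from an arc with other ends; injectivity of
      the vertex map identifies them.\<close>
    then obtain u' v' where e: "(u', v') \<in> parcs F" "(?h u, ?h v) = iso_arcs f (u', v')"
      by auto
    moreover have "u' \<in> pverts F" "v' \<in> pverts F"
      using e(1) F.in_arcsD1 F.in_arcsD2 by auto
    ultimately have "u = u'" "v = v'"
      using iso_arc[OF e(1)] inj uv by (auto intro: inj_onD)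
    with e(1) show "(u, v) \<in> parcs F" by simp
  qed
  with inj H(1) show "embeds F G" unfolding embeds_def by blast
next
  interpret F: pair_wf_digraph F by fact
  interpret G: pair_wf_digraph G by fact
  assume "embeds F G"
  then obtain h where h: "inj_on h (pverts F)" "h ` pverts F \<subseteq> pverts G"
    "\<And>u v. u \<in> pverts F \<Longrightarrow> v \<in> pverts F \<Longrightarrow> (h u, h v) \<in> parcs G \<longleftrightarrow> (u, v) \<in> parcs F"
    by (auto simp: embeds_def)
  let ?f = "\<lparr> iso_verts = h, iso_arcs = map_prod h h, iso_head = snd, iso_tail = fst \<rparr>"
  let ?H = "app_iso ?f (with_proj F)"
  have "parcs F \<subseteq> pverts F \<times> pverts F"
    using F.in_arcsD1 F.in_arcsD2 by auto
  then have "inj_on (map_prod h h) (parcs F)"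
    using map_prod_inj_on[OF h(1) h(1)] inj_on_subset by blast
  then have f: "F.digraph_isomorphism ?f"
    using h(1) F.wf_digraph_axioms by (auto simp: F.digraph_isomorphism_def)
  have "map_prod h h ` parcs F = {e \<in> parcs G. fst e \<in> h ` pverts F \<and> snd e \<in> h ` pverts F}"
    using h(3) F.in_arcsD1 F.in_arcsD2 by fastforce
  then have "induced_subgraph ?H (with_proj G)"
    using h(2) F.wf_digraphI_app_iso[OF f] G.wf_digraph_axioms
    by (auto simp: induced_subgraph_def subgraph_def compatible_def)
  then show "\<exists>H. induced_subgraph H (with_proj G) \<and> digraph_iso (with_proj F) H"
    using f unfolding digraph_iso_def by blast
qed

text \<open>In \<open>graph_free\<close> the isomorphism goes from the subgraph to the forbidden
  graph, so it has to be reversed before vertex maps can be used.\<close>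

lemma graph_free_iff_no_embedding:
  assumes "pair_wf_digraph G" "\<And>F. F \<in> \<F> \<Longrightarrow> pair_wf_digraph F"
  shows "graph_free \<F> G \<longleftrightarrow> (\<forall>F\<in>\<F>. \<not> embeds F G)"
proof -
  have "(\<exists>H. induced_subgraph H (with_proj G) \<and> digraph_iso H (with_proj F)) \<longleftrightarrow> embeds F G"
    if "F \<in> \<F>" for F
  proof -
    interpret F: pair_wf_digraph F using that by (rule assms(2))
    interpret G: pair_wf_digraph G by fact
    have "digraph_iso H (with_proj F) \<longleftrightarrow> digraph_iso (with_proj F) H"
      if "induced_subgraph H (with_proj G)" for H
    proof -
      have "wf_digraph H"
        using that by (simp add: induced_subgraph_def subgraph_def)
      then show ?thesis
        using digraph_iso_swap[of H] digraph_iso_swap[OF F.wf_digraph_axioms] by blast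
    qed
    then show ?thesis
      using iso_induced_subgraph_iff_embeds[OF F.pair_wf_digraph_axioms assms(1)] by blast
  qed
  then show ?thesis
    unfolding graph_free_def by blast
qed

text \<open>Replacing the vertex map by the list of its values leaves sixteen adjacency conditions
  that simplification can decide.\<close>

lemma embeds_four_vertices:
  assumes "pverts F = {0, 1, 2, 3 :: nat}"
  shows "embeds F G \<longleftrightarrow> (\<exists>a b c d. distinct [a, b, c, d] \<and> {a, b, c, d} \<subseteq> pverts G \<and>
    (\<forall>i<4. \<forall>j<4. ([a, b, c, d] ! i, [a, b, c, d] ! j) \<in> parcs G \<longleftrightarrow> (i, j) \<in> parcs F))"
proof -
  have lt_4: "{0, 1, 2, 3} = {..<4 :: nat}" by auto
  show ?thesis
  proof
    assume "embeds F G"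
    then obtain h where h: "inj_on h {..<4}" "h ` {..<4} \<subseteq> pverts G"
      "\<And>i j. i < 4 \<Longrightarrow> j < 4 \<Longrightarrow> (h i, h j) \<in> parcs G \<longleftrightarrow> (i, j) \<in> parcs F"
      unfolding embeds_def assms lt_4 Ball_def lessThan_iff by metis
    have nth: "[h 0, h 1, h 2, h 3] ! i = h i" if "i < 4" for i
      using that by (auto simp: less_Suc_eq numeral_eq_Suc)
    have "distinct [h 0, h 1, h 2, h 3]"
      by (simp add: inj_on_eq_iff[OF h(1)])
    moreover have "{h 0, h 1, h 2, h 3} \<subseteq> pverts G"
      using h(2) by auto
    ultimately show "\<exists>a b c d. distinct [a, b, c, d] \<and> {a, b, c, d} \<subseteq> pverts G \<and>
      (\<forall>i<4. \<forall>j<4. ([a, b, c, d] ! i, [a, b, c, d] ! j) \<in> parcs G \<longleftrightarrow> (i, j) \<in> parcs F)"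
      using h(3) nth
      by (intro exI[of _ "h 0"] exI[of _ "h 1"] exI[of _ "h 2"] exI[of _ "h 3"] conjI allI impI)
        (simp_all only:)
  next
    assume "\<exists>a b c d. distinct [a, b, c, d] \<and> {a, b, c, d} \<subseteq> pverts G \<and>
      (\<forall>i<4. \<forall>j<4. ([a, b, c, d] ! i, [a, b, c, d] ! j) \<in> parcs G \<longleftrightarrow> (i, j) \<in> parcs F)"
    then obtain a b c d where abcd: "distinct [a, b, c, d]" "{a, b, c, d} \<subseteq> pverts G"
      "\<forall>i<4. \<forall>j<4. ([a, b, c, d] ! i, [a, b, c, d] ! j) \<in> parcs G \<longleftrightarrow> (i, j) \<in> parcs F"
      by blast
    have "inj_on (nth [a, b, c, d]) {..<4}"
      using abcd(1) by (intro inj_on_nth) auto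
    moreover have "nth [a, b, c, d] ` {..<4} \<subseteq> pverts G"
    proof
      fix v assume "v \<in> nth [a, b, c, d] ` {..<4}"
      then obtain i where "v = [a, b, c, d] ! i" "i < 4" by blast
      then have "v \<in> set [a, b, c, d]" using nth_mem[of i "[a, b, c, d]"] by simp
      with abcd(2) show "v \<in> pverts G" by auto
    qed
    ultimately show "embeds F G"
      using abcd(3) unfolding embeds_def assms lt_4 Ball_def lessThan_iff by blast
  qed
qed

section \<open>The forbidden graphs as adjacency patterns\<close>

context pair_graph
begin

text \<open>Symmetry and the absence of loops reduce sixteen conditions to six, one per pair of
  vertices. Every vertex lies on an edge, so membership in \<open>pverts G\<close> is implied. The
  next three lemmas work alike.\<close>

lemma embeds_P4_iff:
  "embeds P4 G \<longleftrightarrow> (\<exists>a b c d. distinct [a, b, c, d] \<and> a \<frown> b \<and> b \<frown> c \<and> c \<frown> d \<and>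
     \<not> a \<frown> c \<and> \<not> a \<frown> d \<and> \<not> b \<frown> d)"
  by (subst embeds_four_vertices)
    (auto simp: P4_def graph_of_edges_def numeral_eq_Suc All_less_Suc2 not_adjacent_self
      dest: in_arcsD1 in_arcsD2 arcs_symmetric intro!: ex_cong1)

lemma embeds_C4_iff:
  "embeds C4 G \<longleftrightarrow> (\<exists>a b c d. distinct [a, b, c, d] \<and> a \<frown> b \<and> b \<frown> c \<and> c \<frown> d \<and> d \<frown> a \<and>
     \<not> a \<frown> c \<and> \<not> b \<frown> d)"
  by (subst embeds_four_vertices)
    (auto simp: C4_def graph_of_edges_def numeral_eq_Suc All_less_Suc2 not_adjacent_self
      dest: in_arcsD1 in_arcsD2 arcs_symmetric intro!: ex_cong1)

lemma embeds_paw_iff: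
  "embeds paw G \<longleftrightarrow> (\<exists>a b c d. distinct [a, b, c, d] \<and> a \<frown> b \<and> a \<frown> c \<and> b \<frown> c \<and> c \<frown> d \<and>
     \<not> a \<frown> d \<and> \<not> b \<frown> d)"
  by (subst embeds_four_vertices)
    (auto simp: paw_def graph_of_edges_def numeral_eq_Suc All_less_Suc2 not_adjacent_self
      dest: in_arcsD1 in_arcsD2 arcs_symmetric intro!: ex_cong1)

lemma embeds_diamond_iff:
  "embeds diamond G \<longleftrightarrow> (\<exists>a b c d. distinct [a, b, c, d] \<and> a \<frown> b \<and> a \<frown> c \<and> b \<frown> c \<and> b \<frown> d \<and>
     c \<frown> d \<and> \<not> a \<frown> d)"
  by (subst embeds_four_vertices)
    (auto simp: diamond_def graph_of_edges_def numeral_eq_Suc All_less_Suc2 not_adjacent_self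
      dest: in_arcsD1 in_arcsD2 arcs_symmetric intro!: ex_cong1)

lemma graph_free_forbidden_iff:
  "graph_free {P4, paw, diamond, C4} G \<longleftrightarrow>
     \<not> embeds P4 G \<and> \<not> embeds paw G \<and> \<not> embeds diamond G \<and> \<not> embeds C4 G"
proof -
  have wf: "pair_wf_digraph F" if "F \<in> {P4, paw, diamond, C4}" for F
    using that pair_graph_forbidden pair_graph.axioms(1) pair_digraph.axioms(1)
      pair_fin_digraph.axioms(1) by blast
  show ?thesis
    by (subst graph_free_iff_no_embedding[OF pair_wf_digraph_axioms wf]) auto
qed


section \<open>Complete graphs and stars\<close>

definition is_complete :: bool where
  "is_complete \<longleftrightarrow> (\<forall>u\<in>pverts G. \<forall>v\<in>pverts G. u \<frown> v \<longleftrightarrow> u \<noteq> v)"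

definition is_star_at :: "'a \<Rightarrow> bool" where
  "is_star_at c \<longleftrightarrow> c \<in> pverts G \<and>
     (\<forall>u\<in>pverts G. \<forall>v\<in>pverts G. u \<frown> v \<longleftrightarrow> u \<noteq> v \<and> (u = c \<or> v = c))"

text \<open>\<open>connected\<close> speaks of the symmetric closure, which has the same
  reachability as the symmetric digraph \<open>G\<close>.\<close>

lemma reachable_if_connected:
  assumes "Digraph_Component.connected (with_proj G)" "u \<in> pverts G" "v \<in> pverts G"
  shows "u \<rightarrow>\<^sup>*\<^bsub>with_proj G\<^esub> v"
  using assms reachable_mk_symmetric_eq[OF pair_sym_arcs]
  unfolding connected_def strongly_connected_def by auto

text \<open>Without an induced path on three vertices, "equal or adjacent" passes along arcs, and
  connectedness makes \<open>G\<close> complete. Otherwise the middle \<open>c\<close> of such a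
  path is the centre of a star: excluding paw and diamond makes its neighbours independent, and
  excluding \<open>P4\<close> and \<open>C4\<close> leaves no vertex beyond them.\<close>

lemma complete_or_star_if_free:
  assumes "Digraph_Component.connected (with_proj G)"
    and P4: "\<not> embeds P4 G" and paw: "\<not> embeds paw G"
    and diamond: "\<not> embeds diamond G" and C4: "\<not> embeds C4 G"
  shows "is_complete \<or> (\<exists>c. is_star_at c)"
proof (cases "\<exists>u w c. u \<noteq> w \<and> \<not> u \<frown> w \<and> c \<frown> u \<and> c \<frown> w")
  case False
  have "u = v \<or> u \<frown> v" if "u \<in> pverts G" "v \<in> pverts G" for u v
    using reachable_if_connected[OF assms(1) that]
  proof (induction rule: reachable_induct)
    case (step x y)
    then show ?case using False adjacent_sym[of u x] by auto
  qed simp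
  then show ?thesis
    using not_adjacent_self by (auto simp: is_complete_def)
next
  case True
  then obtain u w c where uw: "u \<noteq> w" "\<not> u \<frown> w" "c \<frown> u" "c \<frown> w" by blast
  \<comment> \<open>Given a triangle on \<open>x\<close>, \<open>y\<close>, \<open>c\<close>, a
    further neighbour \<open>z\<close> of \<open>c\<close> that misses \<open>x\<close> induces a
    diamond or a paw, according to whether it meets \<open>y\<close>.\<close>
  have neighbours: "z \<frown> x" if "c \<frown> x" "c \<frown> y" "x \<frown> y" "c \<frown> z" "z \<noteq> x" "z \<noteq> y" for x y z
  proof (rule ccontr)
    assume "\<not> z \<frown> x"
    moreover have dist: "distinct [x, y, c, z]"
      using that not_adjacent_self by auto
    ultimately show False
    proof (cases "z \<frown> y")
      case True
      have "embeds diamond G"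
        unfolding embeds_diamond_iff
        using that dist True \<open>\<not> z \<frown> x\<close> adjacent_sym
        by (intro exI[of _ x] exI[of _ y] exI[of _ c] exI[of _ z]) auto
      with diamond show False by blast
    next
      case False
      have "embeds paw G"
        unfolding embeds_paw_iff
        using that dist False \<open>\<not> z \<frown> x\<close> adjacent_sym
        by (intro exI[of _ x] exI[of _ y] exI[of _ c] exI[of _ z]) auto
      with paw show False by blast
    qed
  qed
  have independent: "\<not> x \<frown> y" if "c \<frown> x" "c \<frown> y" for x y
  proof
    assume xy: "x \<frown> y"
    have to_x: "z \<frown> x" if "c \<frown> z" "z \<noteq> x" for z
      using neighbours[of x y z] \<open>c \<frown> x\<close> \<open>c \<frown> y\<close> xy that adjacent_sym by blast
    have "u \<noteq> x" "w \<noteq> x"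
      using to_x uw adjacent_sym by blast+
    \<comment> \<open>By \<open>to_x\<close> both \<open>u\<close> and \<open>w\<close> are adjacent
      to \<open>x\<close>. The triangle on \<open>w\<close>, \<open>x\<close>, \<open>c\<close> then
      forces the neighbour \<open>u\<close> of \<open>c\<close> to be adjacent to
      \<open>w\<close>.\<close>
    then have "u \<frown> w"
      using neighbours[of w x u] to_x uw \<open>c \<frown> x\<close> adjacent_sym by blast
    with uw show False by blast
  qed
  have centre: "v = c \<or> c \<frown> v" if "v \<in> pverts G" for v
  proof -
    have "c \<in> pverts G" using uw in_arcsD1 by blast
    from reachable_if_connected[OF assms(1) this that] show ?thesis
    proof (induction rule: reachable_induct)
      case (step a y)
      show ?case
      proof (rule ccontr)
        assume y: "\<not> (y = c \<or> c \<frown> y)"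
        with step have a: "c \<frown> a" "a \<frown> y" by auto
        \<comment> \<open>One of \<open>u\<close> and \<open>w\<close> differs from
          \<open>a\<close>. The path through \<open>b\<close>, \<open>c\<close>, \<open>a\<close>,
          \<open>y\<close> then induces \<open>C4\<close> or \<open>P4\<close>, according to whether
          \<open>y\<close> meets \<open>b\<close>.\<close>
        obtain b where b: "c \<frown> b" "b \<noteq> a" using uw by metis
        have "\<not> a \<frown> b" using independent a b by blast
        have dist: "distinct [b, c, a, y]"
          using a b y not_adjacent_self by auto
        show False
        proof (cases "y \<frown> b")
          case True
          have "embeds C4 G"
            unfolding embeds_C4_iff
            using a b y dist True \<open>\<not> a \<frown> b\<close> adjacent_sym
            by (intro exI[of _ b] exI[of _ c] exI[of _ a] exI[of _ y]) auto
          with C4 show False by blast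
        next
          case False
          have "embeds P4 G"
            unfolding embeds_P4_iff
            using a b y dist False \<open>\<not> a \<frown> b\<close> adjacent_sym
            by (intro exI[of _ b] exI[of _ c] exI[of _ a] exI[of _ y]) auto
          with P4 show False by blast
        qed
      qed
    qed simp
  qed
  have "is_star_at c"
    unfolding is_star_at_def
    using centre independent uw not_adjacent_self adjacent_sym in_arcsD1 by metis
  then show ?thesis by blast
qed

text \<open>Setting every indeterminate to 1 gives the all-ones matrix.\<close>

lemma not_trivial_if_complete:
  assumes is_complete "2 \<le> i"
  shows "\<not> trivial_distance_ideal TYPE(real) G i"
proof (rule not_trivial_if_rank_one[OF assms(2)])
  fix u v assume "u \<in> pverts G" "v \<in> pverts G"
  then show "(if u = v then 1 else 0) + of_nat (graph_dist G u v) = (1 :: real) * 1"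
    using assms(1) by (auto simp: is_complete_def graph_dist_self graph_dist_adjacent)
qed

text \<open>
  The common zero assigns 1/2 to the centre and 2 to the leaves; the matrix is then the outer product
  of \<open>(1/2, 1, \<dots>, 1)\<close> and \<open>(1, 2, \<dots>, 2)\<close>.
\<close>

lemma not_trivial_if_star:
  assumes star: "is_star_at c" and "2 \<le> i"
  shows "\<not> trivial_distance_ideal TYPE(real) G i"
proof (rule not_trivial_if_rank_one[OF assms(2)])
  fix u v assume uv: "u \<in> pverts G" "v \<in> pverts G"
  have "graph_dist G u v = (if u = v then 0 else if u = c \<or> v = c then 1 else 2)"
    using star uv graph_dist_self graph_dist_adjacent graph_dist_eq_2[of u c v]
    by (auto simp: is_star_at_def)
  then show "(if u = v then if u = c then 1 / 2 else 2 else 0) + of_nat (graph_dist G u v) =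
      (if u = c then 1 / 2 else 1) * (if v = c then 1 else 2 :: real)"
    by auto
qed

text \<open>The minors used are 1 or 2 for \<open>P4\<close>, -1 for \<open>paw\<close> and
  \<open>diamond\<close>, and 3 for \<open>C4\<close>.\<close>

lemma trivial_second_distance_ideal_if_embeds:
  assumes "embeds P4 G \<or> embeds paw G \<or> embeds diamond G \<or> embeds C4 G"
  shows "trivial_distance_ideal TYPE(real) G 2"
proof -
  consider "embeds P4 G" | "embeds paw G" | "embeds diamond G" | "embeds C4 G"
    using assms by blast
  then show ?thesis
  proof cases
    case 1
    then obtain a b c d where g: "distinct [a, b, c, d]" "a \<frown> b" "b \<frown> c" "c \<frown> d"
      "\<not> a \<frown> c" "\<not> a \<frown> d" "\<not> b \<frown> d"
      unfolding embeds_P4_iff by blast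
    have "graph_dist G a c = 2" "graph_dist G b d = 2" "graph_dist G b c = 1"
      using g graph_dist_eq_2[of a b c] graph_dist_eq_2[of b c d] graph_dist_adjacent by auto
    moreover have "graph_dist G a d \<in> {2, 3}"
      using g by (intro graph_dist_path_of_length_3[of a b c d])
    ultimately show ?thesis
      using g by (intro trivial_second_distance_ideal[of a b c d]) (auto intro: in_arcsD1 in_arcsD2)
  next
    case 2
    then obtain a b c d where g: "distinct [a, b, c, d]" "a \<frown> b" "a \<frown> c" "b \<frown> c" "c \<frown> d"
      "\<not> a \<frown> d" "\<not> b \<frown> d"
      unfolding embeds_paw_iff by blast
    \<comment> \<open>The rows are \<open>a\<close> and \<open>c\<close>: the vertices
      \<open>a\<close> and \<open>b\<close> are twins in the paw, so the minor on rows
      \<open>a\<close>, \<open>b\<close> and columns \<open>c\<close>, \<open>d\<close> would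
      vanish.\<close>
    have "graph_dist G a d = 2" "graph_dist G a b = 1" "graph_dist G c d = 1" "graph_dist G c b = 1"
      using g graph_dist_eq_2[of a c d] graph_dist_adjacent adjacent_sym by auto
    then show ?thesis
      using g by (intro trivial_second_distance_ideal[of a c b d]) (auto intro: in_arcsD1 in_arcsD2)
  next
    case 3
    then obtain a b c d where g: "distinct [a, b, c, d]" "a \<frown> b" "a \<frown> c" "b \<frown> c" "b \<frown> d" "c \<frown> d"
      "\<not> a \<frown> d"
      unfolding embeds_diamond_iff by blast
    have "graph_dist G a d = 2" "graph_dist G a c = 1" "graph_dist G b d = 1" "graph_dist G b c = 1"
      using g graph_dist_eq_2[of a c d] graph_dist_adjacent by auto
    then show ?thesis
      using g by (intro trivial_second_distance_ideal[of a b c d]) (auto intro: in_arcsD1 in_arcsD2)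
  next
    case 4
    then obtain a b c d where g: "distinct [a, b, c, d]" "a \<frown> b" "b \<frown> c" "c \<frown> d" "d \<frown> a"
      "\<not> a \<frown> c" "\<not> b \<frown> d"
      unfolding embeds_C4_iff by blast
    have "graph_dist G a c = 2" "graph_dist G b d = 2" "graph_dist G a d = 1" "graph_dist G b c = 1"
      using g graph_dist_eq_2[of a b c] graph_dist_eq_2[of b c d] graph_dist_adjacent adjacent_sym
      by auto
    then show ?thesis
      using g by (intro trivial_second_distance_ideal[of a b c d]) (auto intro: in_arcsD1 in_arcsD2)
  qed
qed

lemma trivial_first_distance_ideal_if_edge:
  assumes "u \<frown> v"
  shows "trivial_distance_ideal TYPE(real) G 1"
  using assms not_adjacent_self graph_dist_adjacent[OF assms]
  by (intro trivial_first_distance_ideal[of u G v]) (auto intro: in_arcsD1 in_arcsD2)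

text \<open>Each forbidden graph has two distinct non-adjacent vertices.\<close>

lemma no_forbidden_embedding_if_complete:
  assumes "is_complete"
  shows "\<not> embeds P4 G" "\<not> embeds paw G" "\<not> embeds diamond G" "\<not> embeds C4 G"
  using assms in_arcsD1 in_arcsD2
  unfolding is_complete_def embeds_P4_iff embeds_paw_iff embeds_diamond_iff embeds_C4_iff
  by (metis distinct_length_2_or_more)+

text \<open>Each forbidden graph has two disjoint edges, a-b and c-d, whereas all edges of a star
  share the centre.\<close>

lemma no_forbidden_embedding_if_star:
  assumes "is_star_at c"
  shows "\<not> embeds P4 G" "\<not> embeds paw G" "\<not> embeds diamond G" "\<not> embeds C4 G"
proof -
  have edge: "u = c \<or> v = c" if "u \<frown> v" for u v
    using assms that in_arcsD1[OF that] in_arcsD2[OF that] unfolding is_star_at_def by blast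
  show "\<not> embeds P4 G" "\<not> embeds paw G" "\<not> embeds diamond G" "\<not> embeds C4 G"
    unfolding embeds_P4_iff embeds_paw_iff embeds_diamond_iff embeds_C4_iff
    by (auto dest: edge)
qed

lemma card_trivial_distance_ideals_le_1_iff:
  assumes "Digraph_Component.connected (with_proj G)"
  shows "card {i \<in> {1..card (pverts G)}. trivial_distance_ideal TYPE(real) G i} \<le> 1 \<longleftrightarrow>
    graph_free {P4, paw, diamond, C4} G"
    (is "card ?T \<le> 1 \<longleftrightarrow> _")
proof
  assume card_T: "card ?T \<le> 1"
  show "graph_free {P4, paw, diamond, C4} G"
  proof (rule ccontr)
    assume "\<not> graph_free {P4, paw, diamond, C4} G"
    then have emb: "embeds P4 G \<or> embeds paw G \<or> embeds diamond G \<or> embeds C4 G"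
      by (simp add: graph_free_forbidden_iff)
    then obtain u v where uv: "u \<frown> v"
      unfolding embeds_P4_iff embeds_paw_iff embeds_diamond_iff embeds_C4_iff by blast
    have "{u, v} \<subseteq> pverts G" "u \<noteq> v"
      using uv in_arcsD1[OF uv] in_arcsD2[OF uv] not_adjacent_self by auto
    \<comment> \<open>Only indices up to the number of vertices are counted, so 2 has to be one of
      them.\<close>
    then have "2 \<le> card (pverts G)"
      using card_mono[OF pair_finite_verts, of "{u, v}"] by simp
    then have "{1, 2} \<subseteq> ?T"
      using trivial_first_distance_ideal_if_edge[OF uv]
        trivial_second_distance_ideal_if_embeds[OF emb] by simp
    then have "2 \<le> card ?T"
      using card_mono[of ?T "{1, 2}"] by simp
    with card_T show False by simp
  qed
next
  assume "graph_free {P4, paw, diamond, C4} G"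
  then have "is_complete \<or> (\<exists>c. is_star_at c)"
    using complete_or_star_if_free[OF assms] by (simp add: graph_free_forbidden_iff)
  then have not_trivial: "\<not> trivial_distance_ideal TYPE(real) G i" if "2 \<le> i" for i
    using that not_trivial_if_complete not_trivial_if_star by blast
  have "?T \<subseteq> {1}"
  proof
    fix i assume "i \<in> ?T"
    then show "i \<in> {1}" using not_trivial[of i] by (cases "2 \<le> i") auto
  qed
  then show "card ?T \<le> 1"
    using card_mono[of "{1}" ?T] by simp
qed

end

section \<open>Stars and complete graphs as host graphs\<close>

lemma complete_digraph_imp_is_complete:
  assumes "complete_digraph n (with_proj K)"
  shows "pair_graph.is_complete K"
proof -
  interpret pair_graph K using assms by (rule pair_graphI_complete)
  show ?thesis
    using assms by (auto simp: complete_digraph_pair_def is_complete_def)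
qed

lemma complete_bipartite_digraph_imp_is_star_at:
  assumes "complete_bipartite_digraph 1 n (with_proj K)"
  obtains c where "pair_graph.is_star_at K c"
proof -
  interpret pair_graph K using assms by (rule pair_graphI_complete_bipartite)
  from assms obtain U V where UV: "pverts K = U \<union> V" "U \<inter> V = {}" "card U = 1"
    "parcs K = U \<times> V \<union> V \<times> U"
    by (auto simp: complete_bipartite_digraph_pair_def)
  then obtain c where "U = {c}" by (auto simp: card_1_singleton_iff)
  with UV have "is_star_at c" by (auto simp: is_star_at_def)
  then show thesis by (rule that)
qed

text \<open>Embeddings compose, so a forbidden graph inside \<open>G\<close> would also lie inside
  the host \<open>K\<close>.\<close>

lemma (in pair_graph) no_forbidden_embedding_if_embeds:
  assumes "embeds G K" "complete_bipartite_digraph 1 n (with_proj K) \<or> complete_digraph n (with_proj K)"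
  shows "\<not> embeds P4 G" "\<not> embeds paw G" "\<not> embeds diamond G" "\<not> embeds C4 G"
proof -
  interpret K: pair_graph K
    using assms(2) pair_graphI_complete pair_graphI_complete_bipartite by blast
  have "K.is_complete \<or> (\<exists>c. K.is_star_at c)"
    using assms(2) complete_digraph_imp_is_complete complete_bipartite_digraph_imp_is_star_at by metis
  then have "\<not> embeds P4 K" "\<not> embeds paw K" "\<not> embeds diamond K" "\<not> embeds C4 K"
    using K.no_forbidden_embedding_if_complete K.no_forbidden_embedding_if_star by blast+
  then show "\<not> embeds P4 G" "\<not> embeds paw G" "\<not> embeds diamond G" "\<not> embeds C4 G"
    using embeds_trans[OF _ assms(1)] by blast+
qed

text \<open>The host is a copy of \<open>G\<close> itself, relabelled by natural numbers because the
  theorem asks for hosts of that vertex type.\<close>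

lemma (in pair_graph) embeds_nat_complete_or_star:
  assumes "pverts G \<noteq> {}" "is_complete \<or> (\<exists>c. is_star_at c)"
  obtains n and K :: "nat pair_pre_digraph" where "1 \<le> n" "embeds G K"
    "complete_bipartite_digraph 1 n (with_proj K) \<or> complete_digraph n (with_proj K)"
proof -
  obtain f :: "'a \<Rightarrow> nat" where f: "inj_on f (pverts G)"
    using finite_imp_inj_to_nat_seg[OF pair_finite_verts] by blast
  define K where "K = \<lparr> pverts = f ` pverts G, parcs = map_prod f f ` parcs G \<rparr>"
  have K: "pverts K = f ` pverts G" "parcs K = map_prod f f ` parcs G"
    by (simp_all add: K_def)
  have adj_K: "(f u, f v) \<in> parcs K \<longleftrightarrow> u \<frown> v" if "u \<in> pverts G" "v \<in> pverts G" for u v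
    using that f by (auto simp: K dest: inj_onD in_arcsD1 in_arcsD2)
  have arcs_K: "parcs K \<subseteq> pverts K \<times> pverts K"
    by (auto simp: K dest: in_arcsD1 in_arcsD2)
  have "embeds G K"
    using f adj_K by (auto simp: embeds_def K(1) intro!: exI[of _ f])
  show thesis
  proof (cases "is_complete")
    case True
    have "parcs K = {(u, v). (u, v) \<in> pverts K \<times> pverts K \<and> u \<noteq> v}"
    proof (intro equalityI subrelI)
      fix x y assume "(x, y) \<in> parcs K"
      then show "(x, y) \<in> {(u, v). (u, v) \<in> pverts K \<times> pverts K \<and> u \<noteq> v}"
        using arcs_K adj_K not_adjacent_self by (auto simp: K(1))
    next
      fix x y assume "(x, y) \<in> {(u, v). (u, v) \<in> pverts K \<times> pverts K \<and> u \<noteq> v}"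
      then show "(x, y) \<in> parcs K"
        using True adj_K by (auto simp: K(1) is_complete_def)
    qed
    then have "complete_digraph (card (pverts K)) (with_proj K)"
      using pair_finite_verts by (simp add: complete_digraph_pair_def K(1))
    moreover have "1 \<le> card (pverts K)"
      using assms(1) pair_finite_verts by (simp add: K(1) Suc_le_eq card_gt_0_iff)
    ultimately show thesis using that \<open>embeds G K\<close> by blast
  next
    case False
    with assms(2) obtain c where c: "is_star_at c" by blast
    let ?V = "pverts K - {f c}"
    \<comment> \<open>A one-vertex graph satisfies both predicates. It was treated as complete, so
      here the star has a leaf, as \<open>1 \<le> n\<close> requires.\<close>
    have "\<exists>v\<in>pverts G. v \<noteq> c"
      using False c not_adjacent_self by (auto simp: is_complete_def is_star_at_def)
    then have "?V \<noteq> {}"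
      using c f by (auto simp: K(1) is_star_at_def dest: inj_onD)
    then have "1 \<le> card ?V"
      using pair_finite_verts by (simp add: K(1) Suc_le_eq card_gt_0_iff)
    moreover have "parcs K = {f c} \<times> ?V \<union> ?V \<times> {f c}"
    proof (intro equalityI subrelI)
      fix x y assume xy: "(x, y) \<in> parcs K"
      then obtain u v where "x = f u" "y = f v" "u \<in> pverts G" "v \<in> pverts G"
        using arcs_K by (auto simp: K(1))
      with xy show "(x, y) \<in> {f c} \<times> ?V \<union> ?V \<times> {f c}"
        using c adj_K[of u v] f by (auto simp: K(1) is_star_at_def dest: inj_onD)
    next
      fix x y assume "(x, y) \<in> {f c} \<times> ?V \<union> ?V \<times> {f c}"
      then show "(x, y) \<in> parcs K"
        using c adj_K by (auto simp: K(1) is_star_at_def)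
    qed
    then have "complete_bipartite_digraph 1 (card ?V) (with_proj K)"
      unfolding complete_bipartite_digraph_pair_def
      using c pair_finite_verts
      by (intro conjI exI[of _ "{f c}"] exI[of _ ?V]) (auto simp: K(1) is_star_at_def)
    ultimately show thesis using that \<open>embeds G K\<close> by blast
  qed
qed

theorem theorem25:
  fixes G :: "'v pair_pre_digraph"
  assumes "pair_graph G"
    and "Digraph_Component.connected (with_proj G)"
  shows
    "(card {i \<in> {1..card (pverts G)}. trivial_distance_ideal TYPE(real) G i} \<le> 1
        \<longleftrightarrow> graph_free {P4, paw, diamond, C4} G) \<and>
     (graph_free {P4, paw, diamond, C4} G
        \<longleftrightarrow> (\<exists>n\<ge>1. \<exists>(K :: nat pair_pre_digraph) H.
              (complete_bipartite_digraph 1 n (with_proj K) \<or> complete_digraph n (with_proj K)) \<and>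
              induced_subgraph H (with_proj K) \<and> digraph_iso (with_proj G) H))"
    (is "_ \<and> (?free \<longleftrightarrow> ?sub)")
proof -
  interpret pair_graph G by fact
  \<comment> \<open>Connectedness includes having a vertex; this gives a positive \<open>n\<close>
    when \<open>G\<close> is complete.\<close>
  have nonempty: "pverts G \<noteq> {}"
    using assms(2) by (auto simp: connected_def strongly_connected_def)
  have embeds_iff: "(\<exists>H. induced_subgraph H (with_proj K) \<and> digraph_iso (with_proj G) H) \<longleftrightarrow> embeds G K"
    if "complete_bipartite_digraph 1 n (with_proj K) \<or> complete_digraph n (with_proj K)"
    for n and K :: "nat pair_pre_digraph"
  proof -
    interpret K: pair_graph K
      using that pair_graphI_complete pair_graphI_complete_bipartite by blast
    show ?thesis
      by (rule iso_induced_subgraph_iff_embeds[OF pair_wf_digraph_axioms K.pair_wf_digraph_axioms])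
  qed
  have "?free \<longleftrightarrow> ?sub"
  proof
    assume ?free
    then have "is_complete \<or> (\<exists>c. is_star_at c)"
      using complete_or_star_if_free[OF assms(2)] by (simp add: graph_free_forbidden_iff)
    from embeds_nat_complete_or_star[OF nonempty this] embeds_iff show ?sub by metis
  next
    assume ?sub
    then obtain n and K :: "nat pair_pre_digraph" where
      K: "complete_bipartite_digraph 1 n (with_proj K) \<or> complete_digraph n (with_proj K)"
      and "embeds G K"
      using embeds_iff by blast
    from no_forbidden_embedding_if_embeds[OF this(2) K] show ?free
      by (simp add: graph_free_forbidden_iff)
  qed
  with card_trivial_distance_ideals_le_1_iff[OF assms(2)] show ?thesis by blast
qed

end
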